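(* Let $A$ and $B$ be Frobenius algebras over a field $k$ with Nakayama automorphisms $\alpha: A\to A$ and $\beta: B\to B$, respectively. Then any bimodule ${}_AP_B$ that is finitely generated projective as a left $A$-module and as a right $B$-module is an $\alpha$-$\beta$-Frobenius bimodule. In particular, if $A$ and $B$ are symmetric algebras, then any such $P$ is a Frobenius bimodule.
   Context: Algebras are unital and finite-dimensional over the ground field $k$, and bimodules over $k$-algebras have $k$ acting centrally. For a $k$-space $M$, $M^*=\mathrm{Hom}_k(M,k)$, with the induced bimodule structure when $M$ is a bimodule. Twists: for an algebra automorphism $\alpha$ of $A$ and a left $A$-module $M$, ${}_\alpha M$ is the left $A$-module with the same underlying space and action $a\cdot m=\alpha(a)m$; similarly $M_\alpha$ is the right twist $m\cdot a=m\alpha(a)$ of a right $A$-module. Frobenius algebra with Nakayama automorphism $\alpha$: an algebra $A$ with an isomorphism of $A$-$A$-bimodules ${}_AA_A\cong{}_\alpha (A^* )_A$. Symmetric algebra: ${}_AA_A\cong{}_A(A^* )_A$ as $A$-$A$-bimodules. $\alpha$-$\beta$-Frobenius bimodule (for automorphisms $\alpha$ of $A$ and $\beta$ of $B$): a bimodule ${}_AW_B$ that is finitely generated projective on the left and on the right and for which there is a $B$-$A$-bimodule isomorphism ${}_B\mathrm{Hom}(W_B,B_B)_A\cong{}_\beta\mathrm{Hom}({}_AW,{}_AA)_\alpha$. A Frobenius bimodule is the case $\alpha=\mathrm{id}_A$, $\beta=\mathrm{id}_B$. *)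

theory Defs
  imports "HOL-Algebra.Module" "HOL-Algebra.QuotRing"
begin

text \<open>
  The library locale \<^locale>\<open>module\<close> requires a commutative base ring, so left modules over an
  arbitrary ring are introduced here, on the library record type of modules. Its multiplicative
  fields play no role, and are \<open>undefined\<close> in the modules constructed below.
\<close>

locale left_module = R: ring R + M: abelian_group M
  for R :: "('a, 'r) ring_scheme" (structure)
    and M :: "('a, 'm, 'x) module_scheme" (structure) +
  assumes smult_closed:
      "\<lbrakk>a \<in> carrier R; x \<in> carrier M\<rbrakk> \<Longrightarrow> a \<odot>\<^bsub>M\<^esub> x \<in> carrier M"
    and smult_l_distr:
      "\<lbrakk>a \<in> carrier R; b \<in> carrier R; x \<in> carrier M\<rbrakk> \<Longrightarrow>
        (a \<oplus> b) \<odot>\<^bsub>M\<^esub> x = a \<odot>\<^bsub>M\<^esub> x \<oplus>\<^bsub>M\<^esub> b \<odot>\<^bsub>M\<^esub> x"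
    and smult_r_distr:
      "\<lbrakk>a \<in> carrier R; x \<in> carrier M; y \<in> carrier M\<rbrakk> \<Longrightarrow>
        a \<odot>\<^bsub>M\<^esub> (x \<oplus>\<^bsub>M\<^esub> y) = a \<odot>\<^bsub>M\<^esub> x \<oplus>\<^bsub>M\<^esub> a \<odot>\<^bsub>M\<^esub> y"
    and smult_assoc:
      "\<lbrakk>a \<in> carrier R; b \<in> carrier R; x \<in> carrier M\<rbrakk> \<Longrightarrow>
        (a \<otimes> b) \<odot>\<^bsub>M\<^esub> x = a \<odot>\<^bsub>M\<^esub> (b \<odot>\<^bsub>M\<^esub> x)"
    and smult_one:
      "x \<in> carrier M \<Longrightarrow> \<one> \<odot>\<^bsub>M\<^esub> x = x"

definition left_hom ::
  "('a, 'r) ring_scheme \<Rightarrow> ('a, 'm, 'x) module_scheme \<Rightarrow> ('a, 'n, 'y) module_scheme \<Rightarrow> ('m \<Rightarrow> 'n) set"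
  where "left_hom R M N =
    {f \<in> carrier M \<rightarrow> carrier N.
      (\<forall>x\<in>carrier M. \<forall>y\<in>carrier M. f (x \<oplus>\<^bsub>M\<^esub> y) = f x \<oplus>\<^bsub>N\<^esub> f y) \<and>
      (\<forall>a\<in>carrier R. \<forall>x\<in>carrier M. f (a \<odot>\<^bsub>M\<^esub> x) = a \<odot>\<^bsub>N\<^esub> f x)}"

definition fin_gen :: "('a, 'r) ring_scheme \<Rightarrow> ('a, 'm, 'x) module_scheme \<Rightarrow> bool"
  where "fin_gen R M \<longleftrightarrow>
    (\<exists>S. finite S \<and> S \<subseteq> carrier M \<and>
      (\<forall>x\<in>carrier M. \<exists>c\<in>S \<rightarrow> carrier R. x = (\<Oplus>\<^bsub>M\<^esub>s\<in>S. c s \<odot>\<^bsub>M\<^esub> s)))"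

definition free_left_module :: "('a, 'r) ring_scheme \<Rightarrow> 'i set \<Rightarrow> ('a, 'i \<Rightarrow> 'a) module"
  where "free_left_module R I =
    \<lparr>carrier = {v \<in> I \<rightarrow>\<^sub>E carrier R. finite {i \<in> I. v i \<noteq> \<zero>\<^bsub>R\<^esub>}},
     mult = undefined, one = undefined,
     zero = (\<lambda>i\<in>I. \<zero>\<^bsub>R\<^esub>), add = (\<lambda>v w. \<lambda>i\<in>I. v i \<oplus>\<^bsub>R\<^esub> w i),
     smult = (\<lambda>a v. \<lambda>i\<in>I. a \<otimes>\<^bsub>R\<^esub> v i)\<rparr>"

text \<open>
  Projective means: a direct summand of a free module. Index sets of the free module may be taken
  inside the type of \<open>M\<close>, because a direct summand of any free module is also one of the free module
  on its own elements; see \<open>projective_iff_lifting\<close> and \<open>projective_lifting\<close> below for the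
  lifting property.
\<close>

definition projective :: "('a, 'r) ring_scheme \<Rightarrow> ('a, 'm, 'x) module_scheme \<Rightarrow> bool"
  where "projective R M \<longleftrightarrow>
    (\<exists>I :: 'm set. \<exists>s \<in> left_hom R M (free_left_module R I).
      \<exists>p \<in> left_hom R (free_left_module R I) M. \<forall>x\<in>carrier M. p (s x) = x)"

text \<open>A right module over \<open>B\<close> is treated as a left module over the opposite ring of \<open>B\<close>.\<close>

definition opposite :: "('b, 'r) ring_scheme \<Rightarrow> ('b, 'r) ring_scheme"
  where "opposite B = B\<lparr>mult := \<lambda>x y. y \<otimes>\<^bsub>B\<^esub> x\<rparr>"

record ('a, 'b, 'm) bimodule = "('a, 'm) module" +
  ract :: "'m \<Rightarrow> 'b \<Rightarrow> 'm" (infixl "\<triangleleft>\<index>" 70)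

definition right_part :: "('a, 'b, 'm, 'x) bimodule_scheme \<Rightarrow> ('b, 'm) module"
  where "right_part M =
    \<lparr>carrier = carrier M, mult = mult M, one = one M, zero = zero M, add = add M,
     smult = (\<lambda>b x. x \<triangleleft>\<^bsub>M\<^esub> b)\<rparr>"

locale fd_algebra =
  fixes K :: "('k, 'r) ring_scheme" (structure)
    and A :: "('k, 'a, 'x) module_scheme" (structure)
  assumes field: "field K"
    and ring: "ring A"
    and module: "module K A"
    and smult_mult_left: "\<lbrakk>c \<in> carrier K; x \<in> carrier A; y \<in> carrier A\<rbrakk> \<Longrightarrow>
      (c \<odot>\<^bsub>A\<^esub> x) \<otimes>\<^bsub>A\<^esub> y = c \<odot>\<^bsub>A\<^esub> (x \<otimes>\<^bsub>A\<^esub> y)"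
    and smult_mult_right: "\<lbrakk>c \<in> carrier K; x \<in> carrier A; y \<in> carrier A\<rbrakk> \<Longrightarrow>
      x \<otimes>\<^bsub>A\<^esub> (c \<odot>\<^bsub>A\<^esub> y) = c \<odot>\<^bsub>A\<^esub> (x \<otimes>\<^bsub>A\<^esub> y)"
    and finite_dimensional: "fin_gen K A"

definition algebra_automorphism ::
  "('k, 'r) ring_scheme \<Rightarrow> ('k, 'a, 'x) module_scheme \<Rightarrow> ('a \<Rightarrow> 'a) \<Rightarrow> bool"
  where "algebra_automorphism K A \<alpha> \<longleftrightarrow> \<alpha> \<in> ring_iso A A \<and>
    (\<forall>c\<in>carrier K. \<forall>x\<in>carrier A. \<alpha> (c \<odot>\<^bsub>A\<^esub> x) = c \<odot>\<^bsub>A\<^esub> \<alpha> x)"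

text \<open>
  In a bimodule over \<open>K\<close>-algebras the scalars act through the units of the algebras;
  \<open>central\<close> says that the two resulting actions of \<open>K\<close> agree.
\<close>

locale bimodule =
  A: fd_algebra K A + B: fd_algebra K B + left: left_module A M +
  right: left_module "opposite B" "right_part M"
  for K :: "('k, 'r) ring_scheme" (structure)
    and A :: "('k, 'a, 'x) module_scheme" (structure)
    and B :: "('k, 'b, 'y) module_scheme" (structure)
    and M :: "('a, 'b, 'm, 'z) bimodule_scheme" (structure) +
  assumes assoc: "\<lbrakk>a \<in> carrier A; x \<in> carrier M; b \<in> carrier B\<rbrakk> \<Longrightarrow>
      (a \<odot>\<^bsub>M\<^esub> x) \<triangleleft>\<^bsub>M\<^esub> b = a \<odot>\<^bsub>M\<^esub> (x \<triangleleft>\<^bsub>M\<^esub> b)"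
    and central: "\<lbrakk>c \<in> carrier K; x \<in> carrier M\<rbrakk> \<Longrightarrow>
      (c \<odot>\<^bsub>A\<^esub> \<one>\<^bsub>A\<^esub>) \<odot>\<^bsub>M\<^esub> x = x \<triangleleft>\<^bsub>M\<^esub> (c \<odot>\<^bsub>B\<^esub> \<one>\<^bsub>B\<^esub>)"

definition right_hom ::
  "('b, 'r) ring_scheme \<Rightarrow> ('a, 'b, 'm, 'x) bimodule_scheme \<Rightarrow> ('c, 'b, 'n, 'y) bimodule_scheme
    \<Rightarrow> ('m \<Rightarrow> 'n) set"
  where "right_hom B M N = left_hom (opposite B) (right_part M) (right_part N)"

definition bimodule_iso ::
  "('a, 'r) ring_scheme \<Rightarrow> ('b, 's) ring_scheme \<Rightarrow>
    ('a, 'b, 'm, 'x) bimodule_scheme \<Rightarrow> ('a, 'b, 'n, 'y) bimodule_scheme \<Rightarrow> bool"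
  where "bimodule_iso A B M N \<longleftrightarrow>
    (\<exists>f \<in> left_hom A M N \<inter> right_hom B M N. bij_betw f (carrier M) (carrier N))"

definition left_twist ::
  "('a \<Rightarrow> 'a) \<Rightarrow> ('a, 'b, 'm, 'x) bimodule_scheme \<Rightarrow> ('a, 'b, 'm, 'x) bimodule_scheme"
  where "left_twist \<alpha> M = M\<lparr>smult := \<lambda>a x. \<alpha> a \<odot>\<^bsub>M\<^esub> x\<rparr>"

definition right_twist ::
  "('b \<Rightarrow> 'b) \<Rightarrow> ('a, 'b, 'm, 'x) bimodule_scheme \<Rightarrow> ('a, 'b, 'm, 'x) bimodule_scheme"
  where "right_twist \<beta> M = M\<lparr>ract := \<lambda>x b. x \<triangleleft>\<^bsub>M\<^esub> \<beta> b\<rparr>"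

definition regular :: "('a, 'r) ring_scheme \<Rightarrow> ('a, 'a, 'a) bimodule"
  where "regular A =
    \<lparr>carrier = carrier A, mult = mult A, one = one A, zero = zero A, add = add A,
     smult = mult A, ract = mult A\<rparr>"

definition k_space ::
  "('k, 'a, 'x) module_scheme \<Rightarrow> ('a, 'b, 'm, 'y) bimodule_scheme \<Rightarrow> ('k, 'm) module"
  where "k_space A M =
    \<lparr>carrier = carrier M, mult = mult M, one = one M, zero = zero M, add = add M,
     smult = (\<lambda>c x. (c \<odot>\<^bsub>A\<^esub> \<one>\<^bsub>A\<^esub>) \<odot>\<^bsub>M\<^esub> x)\<rparr>"

text \<open>
  For an \<open>A\<close>-\<open>B\<close>-bimodule \<open>M\<close>, the \<open>B\<close>-\<open>A\<close>-bimodules \<open>M\<^sup>*\<close>, \<open>Hom(M\<^sub>B, B\<^sub>B)\<close> and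
  \<open>Hom(\<^sub>AM, \<^sub>AA)\<close>. Homomorphisms are made extensional so that each is represented by exactly one
  HOL function.
\<close>

definition k_dual ::
  "('k, 'r) ring_scheme \<Rightarrow> ('k, 'a, 'x) module_scheme \<Rightarrow> ('a, 'b, 'm, 'y) bimodule_scheme
    \<Rightarrow> ('b, 'a, 'm \<Rightarrow> 'k) bimodule"
  where "k_dual K A M =
    \<lparr>carrier = left_hom K (k_space A M) (regular K) \<inter> extensional (carrier M),
     mult = undefined, one = undefined,
     zero = (\<lambda>x\<in>carrier M. \<zero>\<^bsub>K\<^esub>), add = (\<lambda>f g. \<lambda>x\<in>carrier M. f x \<oplus>\<^bsub>K\<^esub> g x),
     smult = (\<lambda>b f. \<lambda>x\<in>carrier M. f (x \<triangleleft>\<^bsub>M\<^esub> b)),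
     ract = (\<lambda>f a. \<lambda>x\<in>carrier M. f (a \<odot>\<^bsub>M\<^esub> x))\<rparr>"

definition right_dual ::
  "('b, 's) ring_scheme \<Rightarrow> ('a, 'b, 'm, 'y) bimodule_scheme \<Rightarrow> ('b, 'a, 'm \<Rightarrow> 'b) bimodule"
  where "right_dual B M =
    \<lparr>carrier = right_hom B M (regular B) \<inter> extensional (carrier M),
     mult = undefined, one = undefined,
     zero = (\<lambda>x\<in>carrier M. \<zero>\<^bsub>B\<^esub>), add = (\<lambda>f g. \<lambda>x\<in>carrier M. f x \<oplus>\<^bsub>B\<^esub> g x),
     smult = (\<lambda>b f. \<lambda>x\<in>carrier M. b \<otimes>\<^bsub>B\<^esub> f x),
     ract = (\<lambda>f a. \<lambda>x\<in>carrier M. f (a \<odot>\<^bsub>M\<^esub> x))\<rparr>"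

definition left_dual ::
  "('a, 'r) ring_scheme \<Rightarrow> ('a, 'b, 'm, 'y) bimodule_scheme \<Rightarrow> ('b, 'a, 'm \<Rightarrow> 'a) bimodule"
  where "left_dual A M =
    \<lparr>carrier = left_hom A M (regular A) \<inter> extensional (carrier M),
     mult = undefined, one = undefined,
     zero = (\<lambda>x\<in>carrier M. \<zero>\<^bsub>A\<^esub>), add = (\<lambda>f g. \<lambda>x\<in>carrier M. f x \<oplus>\<^bsub>A\<^esub> g x),
     smult = (\<lambda>b f. \<lambda>x\<in>carrier M. f (x \<triangleleft>\<^bsub>M\<^esub> b)),
     ract = (\<lambda>f a. \<lambda>x\<in>carrier M. f x \<otimes>\<^bsub>A\<^esub> a)\<rparr>"

definition frobenius_algebra ::
  "('k, 'r) ring_scheme \<Rightarrow> ('k, 'a, 'x) module_scheme \<Rightarrow> ('a \<Rightarrow> 'a) \<Rightarrow> bool"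
  where "frobenius_algebra K A \<alpha> \<longleftrightarrow> fd_algebra K A \<and> algebra_automorphism K A \<alpha> \<and>
    bimodule_iso A A (regular A) (left_twist \<alpha> (k_dual K A (regular A)))"

definition symmetric_algebra ::
  "('k, 'r) ring_scheme \<Rightarrow> ('k, 'a, 'x) module_scheme \<Rightarrow> bool"
  where "symmetric_algebra K A \<longleftrightarrow> fd_algebra K A \<and>
    bimodule_iso A A (regular A) (k_dual K A (regular A))"

definition fin_gen_projective_left ::
  "('a, 'r) ring_scheme \<Rightarrow> ('a, 'b, 'm, 'y) bimodule_scheme \<Rightarrow> bool"
  where "fin_gen_projective_left A M \<longleftrightarrow> fin_gen A M \<and> projective A M"

definition fin_gen_projective_right ::
  "('b, 's) ring_scheme \<Rightarrow> ('a, 'b, 'm, 'y) bimodule_scheme \<Rightarrow> bool"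
  where "fin_gen_projective_right B M \<longleftrightarrow>
    fin_gen (opposite B) (right_part M) \<and> projective (opposite B) (right_part M)"

definition twisted_frobenius_bimodule ::
  "('k, 'r) ring_scheme \<Rightarrow> ('k, 'a, 'x) module_scheme \<Rightarrow> ('a \<Rightarrow> 'a) \<Rightarrow>
    ('k, 'b, 'y) module_scheme \<Rightarrow> ('b \<Rightarrow> 'b) \<Rightarrow> ('a, 'b, 'm, 'z) bimodule_scheme \<Rightarrow> bool"
  where "twisted_frobenius_bimodule K A \<alpha> B \<beta> W \<longleftrightarrow>
    algebra_automorphism K A \<alpha> \<and> algebra_automorphism K B \<beta> \<and>
    bimodule K A B W \<and> fin_gen_projective_left A W \<and> fin_gen_projective_right B W \<and>
    bimodule_iso B A (right_dual B W) (left_twist \<beta> (right_twist \<alpha> (left_dual A W)))"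

definition frobenius_bimodule ::
  "('k, 'r) ring_scheme \<Rightarrow> ('k, 'a, 'x) module_scheme \<Rightarrow> ('k, 'b, 'y) module_scheme \<Rightarrow>
    ('a, 'b, 'm, 'z) bimodule_scheme \<Rightarrow> bool"
  where "frobenius_bimodule K A B W \<longleftrightarrow>
    twisted_frobenius_bimodule K A (\<lambda>a. a) B (\<lambda>b. b) W"


subsection \<open>The lifting property of projective modules\<close>

lemma left_homD:
  assumes "f \<in> left_hom R M N"
  shows "x \<in> carrier M \<Longrightarrow> f x \<in> carrier N"
    and "\<lbrakk>x \<in> carrier M; y \<in> carrier M\<rbrakk> \<Longrightarrow> f (x \<oplus>\<^bsub>M\<^esub> y) = f x \<oplus>\<^bsub>N\<^esub> f y"
    and "\<lbrakk>a \<in> carrier R; x \<in> carrier M\<rbrakk> \<Longrightarrow> f (a \<odot>\<^bsub>M\<^esub> x) = a \<odot>\<^bsub>N\<^esub> f x"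
  using assms by (auto simp: left_hom_def)

lemma left_hom_compose:
  assumes "f \<in> left_hom R M N" "g \<in> left_hom R N Q"
  shows "(\<lambda>x. g (f x)) \<in> left_hom R M Q"
  using left_homD[OF assms(1)] left_homD[OF assms(2)] by (simp add: left_hom_def)

lemma (in left_module) smult_zero_left: "x \<in> carrier M \<Longrightarrow> \<zero> \<odot>\<^bsub>M\<^esub> x = \<zero>\<^bsub>M\<^esub>"
  by (metis M.add.r_cancel_one' R.l_zero R.zero_closed smult_closed smult_l_distr)

lemma (in left_module) smult_zero_right: "a \<in> carrier R \<Longrightarrow> a \<odot>\<^bsub>M\<^esub> \<zero>\<^bsub>M\<^esub> = \<zero>\<^bsub>M\<^esub>"
  by (metis M.add.r_cancel_one' M.l_zero M.zero_closed smult_closed smult_r_distr)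

lemma (in left_module) smult_finsum:
  assumes "a \<in> carrier R" "finite S" "f \<in> S \<rightarrow> carrier M"
  shows "a \<odot>\<^bsub>M\<^esub> (\<Oplus>\<^bsub>M\<^esub>i\<in>S. f i) = (\<Oplus>\<^bsub>M\<^esub>i\<in>S. a \<odot>\<^bsub>M\<^esub> f i)"
  using assms(2,3)
proof (induction S)
  case empty
  then show ?case using assms(1) by (simp add: smult_zero_right)
next
  case (insert i S)
  then have f: "f \<in> S \<rightarrow> carrier M" "f i \<in> carrier M" by auto
  then have g: "(\<lambda>i. a \<odot>\<^bsub>M\<^esub> f i) \<in> S \<rightarrow> carrier M" "a \<odot>\<^bsub>M\<^esub> f i \<in> carrier M"
    using assms(1) by (auto intro: smult_closed)
  show ?case using insert f g assms(1) by (simp add: smult_r_distr)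
qed

lemma hom_finsum:
  assumes "left_module R M" "left_module R N" "f \<in> left_hom R M N"
    and "finite S" "g \<in> S \<rightarrow> carrier M"
  shows "f (\<Oplus>\<^bsub>M\<^esub>i\<in>S. g i) = (\<Oplus>\<^bsub>N\<^esub>i\<in>S. f (g i))"
proof -
  interpret M: left_module R M by fact
  interpret N: left_module R N by fact
  note hom = left_homD[OF assms(3)]
  have 0: "f \<zero>\<^bsub>M\<^esub> = \<zero>\<^bsub>N\<^esub>"
    by (metis hom(1,2) M.M.l_zero M.M.zero_closed N.M.add.r_cancel_one')
  show ?thesis using assms(4,5)
  proof (induction S)
    case empty
    then show ?case by (simp add: 0)
  next
    case (insert i S)
    then have g: "g \<in> S \<rightarrow> carrier M" "g i \<in> carrier M" by auto
    then have "(\<lambda>i. f (g i)) \<in> S \<rightarrow> carrier N" "f (g i) \<in> carrier N" using hom(1) by auto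
    then show ?case using insert g by (simp add: hom(2))
  qed
qed

text \<open>The homomorphism on a free module that takes prescribed values \<open>n\<close> on the basis.\<close>

definition free_ext ::
  "('a, 'r) ring_scheme \<Rightarrow> 'i set \<Rightarrow> ('a, 'n, 'x) module_scheme \<Rightarrow> ('i \<Rightarrow> 'n) \<Rightarrow> ('i \<Rightarrow> 'a) \<Rightarrow> 'n"
  where "free_ext R I N n v = (\<Oplus>\<^bsub>N\<^esub>i\<in>{i \<in> I. v i \<noteq> \<zero>\<^bsub>R\<^esub>}. v i \<odot>\<^bsub>N\<^esub> n i)"

context left_module
begin

lemma free_ext_superset:
  assumes "v \<in> I \<rightarrow> carrier R" "n \<in> I \<rightarrow> carrier M"
    and "finite S" "S \<subseteq> I" "{i \<in> I. v i \<noteq> \<zero>} \<subseteq> S"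
  shows "free_ext R I M n v = (\<Oplus>\<^bsub>M\<^esub>i\<in>S. v i \<odot>\<^bsub>M\<^esub> n i)"
  unfolding free_ext_def
  by (rule M.add.finprod_mono_neutral_cong_left)
    (use assms in \<open>auto simp: Pi_def subset_iff intro!: smult_closed smult_zero_left\<close>)

lemma free_ext_hom:
  assumes n: "n \<in> I \<rightarrow> carrier M"
  shows "free_ext R I M n \<in> left_hom R (free_left_module R I) M"
proof -
  let ?F = "free_left_module R I" and ?s = "\<lambda>v. {i \<in> I. v i \<noteq> \<zero>}"
  have F: "v \<in> I \<rightarrow> carrier R" "finite (?s v)" if "v \<in> carrier ?F" for v
    using that by (auto simp: free_left_module_def PiE_iff)
  have sm: "(\<lambda>i. v i \<odot>\<^bsub>M\<^esub> n i) \<in> S \<rightarrow> carrier M" if "v \<in> carrier ?F" "S \<subseteq> I" for v S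
    using F(1)[OF that(1)] that(2) n by (auto simp: Pi_def intro!: smult_closed)
  have closed: "free_ext R I M n v \<in> carrier M" if "v \<in> carrier ?F" for v
    unfolding free_ext_def by (rule M.finsum_closed, rule sm) (use that in auto)
  have add: "free_ext R I M n (v \<oplus>\<^bsub>?F\<^esub> w) = free_ext R I M n v \<oplus>\<^bsub>M\<^esub> free_ext R I M n w"
    if v: "v \<in> carrier ?F" and w: "w \<in> carrier ?F" for v w
  proof -
    let ?S = "?s v \<union> ?s w"
    have S: "finite ?S" "?S \<subseteq> I" using F(2) v w by auto
    have vw: "(v \<oplus>\<^bsub>?F\<^esub> w) i = v i \<oplus> w i" if "i \<in> I" for i
      using that by (simp add: free_left_module_def)
    have "free_ext R I M n (v \<oplus>\<^bsub>?F\<^esub> w) = (\<Oplus>\<^bsub>M\<^esub>i\<in>?S. (v \<oplus>\<^bsub>?F\<^esub> w) i \<odot>\<^bsub>M\<^esub> n i)"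
      by (rule free_ext_superset[OF _ n S])
        (use F(1)[OF v] F(1)[OF w] vw in \<open>auto simp: Pi_def\<close>)
    also have "\<dots> = (\<Oplus>\<^bsub>M\<^esub>i\<in>?S. v i \<odot>\<^bsub>M\<^esub> n i \<oplus>\<^bsub>M\<^esub> w i \<odot>\<^bsub>M\<^esub> n i)"
      by (rule M.finsum_cong')
        (use F(1)[OF v] F(1)[OF w] vw n in \<open>auto simp: Pi_def smult_l_distr intro!: smult_closed\<close>)
    also have "\<dots> = (\<Oplus>\<^bsub>M\<^esub>i\<in>?S. v i \<odot>\<^bsub>M\<^esub> n i) \<oplus>\<^bsub>M\<^esub> (\<Oplus>\<^bsub>M\<^esub>i\<in>?S. w i \<odot>\<^bsub>M\<^esub> n i)"
      by (rule M.finsum_addf[OF sm[OF v S(2)] sm[OF w S(2)]])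
    also have "(\<Oplus>\<^bsub>M\<^esub>i\<in>?S. v i \<odot>\<^bsub>M\<^esub> n i) = free_ext R I M n v"
      by (rule free_ext_superset[OF F(1)[OF v] n S, symmetric]) auto
    also have "(\<Oplus>\<^bsub>M\<^esub>i\<in>?S. w i \<odot>\<^bsub>M\<^esub> n i) = free_ext R I M n w"
      by (rule free_ext_superset[OF F(1)[OF w] n S, symmetric]) auto
    finally show ?thesis .
  qed
  have smult: "free_ext R I M n (a \<odot>\<^bsub>?F\<^esub> v) = a \<odot>\<^bsub>M\<^esub> free_ext R I M n v"
    if a: "a \<in> carrier R" and v: "v \<in> carrier ?F" for a v
  proof -
    have av: "(a \<odot>\<^bsub>?F\<^esub> v) i = a \<otimes> v i" if "i \<in> I" for i
      using that by (simp add: free_left_module_def)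
    have "free_ext R I M n (a \<odot>\<^bsub>?F\<^esub> v) = (\<Oplus>\<^bsub>M\<^esub>i\<in>?s v. (a \<odot>\<^bsub>?F\<^esub> v) i \<odot>\<^bsub>M\<^esub> n i)"
      by (rule free_ext_superset[OF _ n F(2)[OF v]])
        (use F(1)[OF v] av a in \<open>auto simp: Pi_def\<close>)
    also have "\<dots> = (\<Oplus>\<^bsub>M\<^esub>i\<in>?s v. a \<odot>\<^bsub>M\<^esub> (v i \<odot>\<^bsub>M\<^esub> n i))"
      by (rule M.finsum_cong')
        (use F(1)[OF v] av n a in \<open>auto simp: Pi_def smult_assoc intro!: smult_closed\<close>)
    also have "\<dots> = a \<odot>\<^bsub>M\<^esub> free_ext R I M n v"
      unfolding free_ext_def
      by (rule smult_finsum[OF a F(2)[OF v] sm[OF v], symmetric]) auto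
    finally show ?thesis .
  qed
  show ?thesis using closed add smult by (auto simp: left_hom_def)
qed

lemma free_ext_basis:
  assumes "i \<in> I" "n \<in> I \<rightarrow> carrier M"
  shows "free_ext R I M n (\<lambda>j\<in>I. if j = i then \<one> else \<zero>) = n i"
proof -
  have n: "n i \<in> carrier M" using assms by auto
  have "free_ext R I M n (\<lambda>j\<in>I. if j = i then \<one> else \<zero>) =
      (\<Oplus>\<^bsub>M\<^esub>j\<in>{i}. (\<lambda>j\<in>I. if j = i then \<one> else \<zero>) j \<odot>\<^bsub>M\<^esub> n j)"
    by (rule free_ext_superset) (use assms in auto)
  also have "\<dots> = n i" using assms(1) n by (simp add: smult_one)
  finally show ?thesis .
qed

end

lemma free_left_module: 
  assumes "ring R"
  shows "left_module R (free_left_module R I)"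
proof -
  interpret ring R by fact
  let ?F = "free_left_module R I"
  have F: "v \<in> carrier ?F \<longleftrightarrow> v \<in> I \<rightarrow>\<^sub>E carrier R \<and> finite {i \<in> I. v i \<noteq> \<zero>\<^bsub>R\<^esub>}" for v
    by (simp add: free_left_module_def)
  have add: "v \<oplus>\<^bsub>?F\<^esub> w \<in> carrier ?F" if "v \<in> carrier ?F" "w \<in> carrier ?F" for v w
  proof -
    have "{i \<in> I. v i \<oplus>\<^bsub>R\<^esub> w i \<noteq> \<zero>\<^bsub>R\<^esub>} \<subseteq> {i \<in> I. v i \<noteq> \<zero>\<^bsub>R\<^esub>} \<union> {i \<in> I. w i \<noteq> \<zero>\<^bsub>R\<^esub>}" by auto
    then have "finite {i \<in> I. v i \<oplus>\<^bsub>R\<^esub> w i \<noteq> \<zero>\<^bsub>R\<^esub>}"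
      by (rule finite_subset) (use that F in auto)
    then show ?thesis using that
      by (auto simp: free_left_module_def PiE_iff cong: conj_cong)
  qed
  have smult: "a \<odot>\<^bsub>?F\<^esub> v \<in> carrier ?F" if "a \<in> carrier R" "v \<in> carrier ?F" for a v
  proof -
    have "{i \<in> I. a \<otimes>\<^bsub>R\<^esub> v i \<noteq> \<zero>\<^bsub>R\<^esub>} \<subseteq> {i \<in> I. v i \<noteq> \<zero>\<^bsub>R\<^esub>}" using that(1) by auto
    then have "finite {i \<in> I. a \<otimes>\<^bsub>R\<^esub> v i \<noteq> \<zero>\<^bsub>R\<^esub>}"
      by (rule finite_subset) (use that F in auto)
    then show ?thesis using that
      by (auto simp: free_left_module_def PiE_iff cong: conj_cong)
  qed
  have neg: "\<exists>w\<in>carrier ?F. w \<oplus>\<^bsub>?F\<^esub> v = \<zero>\<^bsub>?F\<^esub>" if v: "v \<in> carrier ?F" for v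
  proof (rule bexI)
    let ?w = "\<lambda>i\<in>I. \<ominus>\<^bsub>R\<^esub> v i"
    have "{i \<in> I. \<ominus>\<^bsub>R\<^esub> v i \<noteq> \<zero>\<^bsub>R\<^esub>} \<subseteq> {i \<in> I. v i \<noteq> \<zero>\<^bsub>R\<^esub>}" by auto
    then have "finite {i \<in> I. \<ominus>\<^bsub>R\<^esub> v i \<noteq> \<zero>\<^bsub>R\<^esub>}" by (rule finite_subset) (use v F in auto)
    then show "?w \<in> carrier ?F" using v
      by (auto simp: free_left_module_def PiE_iff cong: conj_cong)
    show "?w \<oplus>\<^bsub>?F\<^esub> v = \<zero>\<^bsub>?F\<^esub>" using v
      by (auto simp: free_left_module_def PiE_iff l_neg intro!: restrict_ext)
  qed
  have ab: "abelian_group ?F"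
    by (rule abelian_groupI)
      (use add neg in \<open>auto simp: free_left_module_def PiE_iff a_ac extensional_def fun_eq_iff\<close>)
  show ?thesis
    by (intro left_module.intro left_module_axioms.intro assms ab smult)
      (auto simp: free_left_module_def PiE_iff l_distr r_distr m_assoc extensional_def fun_eq_iff)
qed

lemma free_hom_eq:
  assumes "left_module R N" "f \<in> left_hom R (free_left_module R I) N"
    and v: "v \<in> carrier (free_left_module R I)"
  shows "f v = free_ext R I N (\<lambda>i. f (\<lambda>j\<in>I. if j = i then \<one>\<^bsub>R\<^esub> else \<zero>\<^bsub>R\<^esub>)) v"
proof -
  interpret N: left_module R N by fact
  let ?F = "free_left_module R I"
  let ?e = "\<lambda>i. \<lambda>j\<in>I. if j = i then \<one>\<^bsub>R\<^esub> else \<zero>\<^bsub>R\<^esub>"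
  interpret F: left_module R ?F by (rule free_left_module) unfold_locales
  note hom = left_homD[OF assms(2)]
  have e: "?e i \<in> carrier ?F" if "i \<in> I" for i
    using that by (auto simp: free_left_module_def)
  have n: "(\<lambda>i. f (?e i)) \<in> I \<rightarrow> carrier N" using e hom(1) by auto
  note ext = left_homD[OF N.free_ext_hom[OF n]]
  have split: "v = (\<Oplus>\<^bsub>?F\<^esub>i\<in>S. v i \<odot>\<^bsub>?F\<^esub> ?e i)"
    if "finite S" "S \<subseteq> I" "v \<in> carrier ?F" "{i \<in> I. v i \<noteq> \<zero>\<^bsub>R\<^esub>} \<subseteq> S" for S v
    using that
  proof (induction S arbitrary: v)
    case empty
    then have "v = \<zero>\<^bsub>?F\<^esub>" by (auto simp: free_left_module_def PiE_iff extensional_def fun_eq_iff)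
    then show ?case by simp
  next
    case (insert k S)
    let ?w = "\<lambda>i\<in>I. if i = k then \<zero>\<^bsub>R\<^esub> else v i"
    have k: "k \<in> I" "v k \<in> carrier R" using insert by (auto simp: free_left_module_def PiE_iff)
    have v: "v i \<in> carrier R" if "i \<in> I" for i
      using insert that by (auto simp: free_left_module_def PiE_iff)
    have ve: "v i \<odot>\<^bsub>?F\<^esub> ?e i \<in> carrier ?F" if "i \<in> I" for i
      by (rule F.smult_closed[OF v[OF that] e[OF that]])
    have sub: "{i \<in> I. ?w i \<noteq> \<zero>\<^bsub>R\<^esub>} \<subseteq> S" using insert by (auto split: if_splits)
    have "finite {i \<in> I. ?w i \<noteq> \<zero>\<^bsub>R\<^esub>}" using finite_subset[OF sub insert.hyps(1)] .
    then have w: "?w \<in> carrier ?F" using v by (auto simp: free_left_module_def)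
    have wi: "?w i = v i" if "i \<in> S" for i
      using that insert by auto
    have "v = v k \<odot>\<^bsub>?F\<^esub> ?e k \<oplus>\<^bsub>?F\<^esub> ?w"
      using insert v k by (auto simp: free_left_module_def PiE_iff extensional_def fun_eq_iff)
    also have "?w = (\<Oplus>\<^bsub>?F\<^esub>i\<in>S. ?w i \<odot>\<^bsub>?F\<^esub> ?e i)"
      by (rule insert.IH[OF _ w sub]) (use insert in auto)
    also have "\<dots> = (\<Oplus>\<^bsub>?F\<^esub>i\<in>S. v i \<odot>\<^bsub>?F\<^esub> ?e i)"
      by (rule F.M.finsum_cong') (use insert ve wi in \<open>auto simp del: restrict_apply\<close>)
    also have "v k \<odot>\<^bsub>?F\<^esub> ?e k \<oplus>\<^bsub>?F\<^esub> \<dots> = (\<Oplus>\<^bsub>?F\<^esub>i\<in>insert k S. v i \<odot>\<^bsub>?F\<^esub> ?e i)"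
      by (rule F.M.finsum_insert[symmetric])
        (use insert v ve in \<open>auto simp del: restrict_apply\<close>)
    finally show ?case .
  qed
  let ?S = "{i \<in> I. v i \<noteq> \<zero>\<^bsub>R\<^esub>}"
  have S: "finite ?S" "?S \<subseteq> I" using v by (auto simp: free_left_module_def)
  have vi: "v i \<in> carrier R" if "i \<in> I" for i
    using v that by (auto simp: free_left_module_def PiE_iff)
  have ve: "v i \<odot>\<^bsub>?F\<^esub> ?e i \<in> carrier ?F"
    and fe: "f (v i \<odot>\<^bsub>?F\<^esub> ?e i) = v i \<odot>\<^bsub>N\<^esub> f (?e i)"
    and nf: "v i \<odot>\<^bsub>N\<^esub> f (?e i) \<in> carrier N" if "i \<in> I" for i
    using F.smult_closed[OF vi[OF that] e[OF that]] hom(3)[OF vi[OF that] e[OF that]]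
      N.smult_closed[OF vi[OF that] hom(1)[OF e[OF that]]] by auto
  have "f v = f (\<Oplus>\<^bsub>?F\<^esub>i\<in>?S. v i \<odot>\<^bsub>?F\<^esub> ?e i)"
    using split[OF S v] by simp
  also have "\<dots> = (\<Oplus>\<^bsub>N\<^esub>i\<in>?S. f (v i \<odot>\<^bsub>?F\<^esub> ?e i))"
    by (rule hom_finsum[OF F.left_module_axioms assms(1,2) S(1)])
      (use ve in \<open>auto simp del: restrict_apply\<close>)
  also have "\<dots> = (\<Oplus>\<^bsub>N\<^esub>i\<in>?S. v i \<odot>\<^bsub>N\<^esub> f (?e i))"
    by (rule N.M.finsum_cong') (use fe nf in auto)
  finally show ?thesis by (simp add: free_ext_def)
qed

lemma projective_lifting:
  fixes R :: "('a, 'r) ring_scheme" and M :: "('a, 'm, 'x) module_scheme"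
  assumes M: "left_module R M" "projective R M"
    and N: "left_module R N" and Q: "left_module R Q"
    and g: "g \<in> left_hom R N Q" "g ` carrier N = carrier Q"
    and f: "f \<in> left_hom R M Q"
  shows "\<exists>h \<in> left_hom R M N. \<forall>x\<in>carrier M. g (h x) = f x"
proof -
  interpret N: left_module R N by fact
  obtain I :: "'m set" and s p where s: "s \<in> left_hom R M (free_left_module R I)"
    and p: "p \<in> left_hom R (free_left_module R I) M" and ps: "\<forall>x\<in>carrier M. p (s x) = x"
    using M(2) unfolding projective_def by blast
  let ?F = "free_left_module R I"
  let ?e = "\<lambda>i. \<lambda>j\<in>I. if j = i then \<one>\<^bsub>R\<^esub> else \<zero>\<^bsub>R\<^esub>"
  have e: "?e i \<in> carrier ?F" if "i \<in> I" for i
    using that by (auto simp: free_left_module_def)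
  have "\<exists>n. n \<in> carrier N \<and> g n = f (p (?e i))" if "i \<in> I" for i
    using g(2) left_homD(1)[OF f, OF left_homD(1)[OF p, OF e[OF that]]] by (metis imageE)
  then obtain n where n: "\<And>i. i \<in> I \<Longrightarrow> n i \<in> carrier N \<and> g (n i) = f (p (?e i))"
    by metis
  then have n': "n \<in> I \<rightarrow> carrier N" by auto
  let ?h = "free_ext R I N n"
  note h = N.free_ext_hom[OF n']
  have fp: "(\<lambda>v. f (p v)) \<in> left_hom R ?F Q" by (rule left_hom_compose[OF p f])
  have gh: "(\<lambda>v. g (?h v)) \<in> left_hom R ?F Q" by (rule left_hom_compose[OF h g(1)])
  have hs: "(\<lambda>x. ?h (s x)) \<in> left_hom R M N" by (rule left_hom_compose[OF s h])
  interpret Q: left_module R Q by fact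
  have eq: "g (?h v) = f (p v)" if v: "v \<in> carrier ?F" for v
  proof -
    have vi: "v i \<in> carrier R" if "i \<in> I" for i
      using v that by (auto simp: free_left_module_def PiE_iff)
    have ge: "g (?h (?e i)) = f (p (?e i))" if "i \<in> I" for i
      by (simp only: N.free_ext_basis[OF that n'] n[OF that])
    have "g (?h v) = free_ext R I Q (\<lambda>i. g (?h (?e i))) v"
      by (rule free_hom_eq[OF Q gh v])
    also have "\<dots> = free_ext R I Q (\<lambda>i. f (p (?e i))) v"
      unfolding free_ext_def[of _ _ Q]
      by (rule Q.M.finsum_cong')
        (use ge vi left_homD(1)[OF fp e] in
          \<open>simp_all add: Pi_def Q.smult_closed del: restrict_apply\<close>)
    also have "\<dots> = f (p v)" by (rule free_hom_eq[OF Q fp v, symmetric])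
    finally show ?thesis .
  qed
  have "g (?h (s x)) = f x" if "x \<in> carrier M" for x
    using eq[OF left_homD(1)[OF s that]] ps that by simp
  then show ?thesis by (intro bexI[OF _ hs] ballI)
qed

lemma projective_iff_lifting:
  fixes R :: "('a, 'r) ring_scheme" and M :: "('a, 'm) module"
  assumes M: "left_module R M"
  shows "projective R M \<longleftrightarrow>
    (\<forall>(N :: ('a, 'm \<Rightarrow> 'a) module) (Q :: ('a, 'm) module) g f.
      left_module R N \<and> left_module R Q \<and> g \<in> left_hom R N Q \<and> g ` carrier N = carrier Q \<and>
      f \<in> left_hom R M Q \<longrightarrow> (\<exists>h \<in> left_hom R M N. \<forall>x\<in>carrier M. g (h x) = f x))"
    (is "_ \<longleftrightarrow> ?lift")
proof
  assume "projective R M"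
  then show ?lift using projective_lifting[OF M] by blast
next
  assume lift: ?lift
  interpret M: left_module R M by fact
  let ?I = "carrier M"
  let ?F = "free_left_module R ?I" and ?g = "free_ext R ?I M (\<lambda>x. x)"
  have F: "left_module R ?F" by (rule free_left_module) unfold_locales
  have g: "?g \<in> left_hom R ?F M" by (rule M.free_ext_hom) auto
  have "x \<in> ?g ` carrier ?F" if "x \<in> carrier M" for x
  proof (rule image_eqI)
    let ?v = "\<lambda>j\<in>?I. if j = x then \<one>\<^bsub>R\<^esub> else \<zero>\<^bsub>R\<^esub>"
    show "x = ?g ?v"
      by (rule M.free_ext_basis[symmetric]) (use that in auto)
    show "?v \<in> carrier ?F" by (auto simp: free_left_module_def)
  qed
  then have sur: "?g ` carrier ?F = carrier M" using left_homD(1)[OF g] by auto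
  have id: "(\<lambda>x. x) \<in> left_hom R M M" by (auto simp: left_hom_def)
  have "\<exists>h \<in> left_hom R M ?F. \<forall>x\<in>carrier M. ?g (h x) = x"
    using lift F M g sur id by blast
  then show "projective R M" using g unfolding projective_def by blast
qed

end

theory Submission
  imports Defs
begin

text \<open>
  Both one-sided duals of \<open>P\<close> are the \<open>k\<close>-dual \<open>P\<^sup>*\<close> up to a twist, and this is seen by composing
  with a Frobenius form. Let \<open>\<phi>\<close> be the isomorphism from \<open>A\<close> to the twisted dual of \<open>A\<close>, and put
  \<open>l = \<phi>(1)\<close>. Linearity of \<open>\<phi>\<close> on the two sides gives \<open>\<phi>(a) = (x \<mapsto> l(ax)) = (x \<mapsto> l(x\<alpha>(a)))\<close>, so every
  functional on \<open>A\<close> is \<open>x \<mapsto> l(xy)\<close> for exactly one \<open>y\<close>, is \<open>x \<mapsto> l(yx)\<close> for exactly one \<open>y\<close>, and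
  \<open>l(ax) = l(x\<alpha>(a))\<close>.

  For a left module \<open>M\<close>, a functional \<open>g\<close> on \<open>M\<close> and \<open>p \<in> M\<close>, the functional \<open>a \<mapsto> g(ap)\<close> on \<open>A\<close> is
  represented by a unique \<open>f(p)\<close>, and uniqueness makes \<open>f\<close> linear. Hence \<open>f \<mapsto> l \<circ> f\<close> is a bijection
  from \<open>Hom(\<^sub>AM, \<^sub>AA)\<close> onto \<open>M\<^sup>*\<close> (lemma \<open>bij_betw_functionals\<close>). For right modules the same lemma
  is applied to the opposite ring. The rule \<open>l(ax) = l(x\<alpha>(a))\<close> then tells how the bimodule
  actions are transported: with \<open>m\<close> the form of \<open>B\<close>, composition with \<open>l\<close> identifies
  \<open>Hom(\<^sub>AP, \<^sub>AA)\<^sub>\<alpha>\<close> with \<open>P\<^sup>*\<close>, and composition with \<open>m\<close> identifies \<open>Hom(P\<^sub>B, B\<^sub>B)\<close> with the left twist of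
  \<open>P\<^sup>*\<close> by \<open>\<beta>\<close>. Twisting the first by \<open>\<beta>\<close> and comparing gives the isomorphism. A symmetric algebra is a
  Frobenius algebra whose Nakayama automorphism is the identity.
\<close>

section \<open>Generating functionals\<close>

text \<open>
  The map \<open>e\<close> stands for \<open>c \<mapsto> c\<cdot>1\<close>. It is kept abstract because a right module over \<open>B\<close> is a left
  module over the opposite ring, on which the same \<open>e\<close> serves.
\<close>

definition restrict_scalars ::
  "('k \<Rightarrow> 'a) \<Rightarrow> ('a, 'm, 'x) module_scheme \<Rightarrow> ('k, 'm) module"
  where "restrict_scalars e M =
    \<lparr>carrier = carrier M, mult = undefined, one = undefined, zero = zero M, add = add M,
     smult = (\<lambda>c x. e c \<odot>\<^bsub>M\<^esub> x)\<rparr>"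

locale generating_functional = ring R
  for K :: "('k, 's) ring_scheme" and R :: "('a, 'r) ring_scheme" (structure)
    and e :: "'k \<Rightarrow> 'a" and l :: "'a \<Rightarrow> 'k" +
  assumes scalar_closed: "c \<in> carrier K \<Longrightarrow> e c \<in> carrier R"
    and functional: "l \<in> left_hom K (restrict_scalars e (regular R)) (regular K)"
    and represents: "h \<in> left_hom K (restrict_scalars e (regular R)) (regular K) \<Longrightarrow>
      \<exists>y\<in>carrier R. \<forall>x\<in>carrier R. h x = l (x \<otimes> y)"
    and nondegenerate: "\<lbrakk>y \<in> carrier R; z \<in> carrier R; \<forall>x\<in>carrier R. l (x \<otimes> y) = l (x \<otimes> z)\<rbrakk> \<Longrightarrow> y = z"
begin

lemma functional_closed: "x \<in> carrier R \<Longrightarrow> l x \<in> carrier K"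
  and functional_add: "\<lbrakk>x \<in> carrier R; y \<in> carrier R\<rbrakk> \<Longrightarrow> l (x \<oplus> y) = l x \<oplus>\<^bsub>K\<^esub> l y"
  and functional_scalar: "\<lbrakk>c \<in> carrier K; x \<in> carrier R\<rbrakk> \<Longrightarrow> l (e c \<otimes> x) = c \<otimes>\<^bsub>K\<^esub> l x"
  using functional by (auto simp: left_hom_def restrict_scalars_def regular_def)

text \<open>
  A functional \<open>g\<close> on \<open>M\<close> comes from the map sending \<open>p\<close> to the element that represents
  \<open>a \<mapsto> g(ap)\<close>. Evaluating the representation at \<open>1\<close> recovers \<open>g\<close>.
\<close>

lemma bij_betw_functionals:
  assumes "left_module R M"
  shows "bij_betw (\<lambda>f. \<lambda>x\<in>carrier M. l (f x))
    (left_hom R M (regular R) \<inter> extensional (carrier M))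
    (left_hom K (restrict_scalars e M) (regular K) \<inter> extensional (carrier M))"
    (is "bij_betw ?F ?H ?D")
proof -
  interpret M: left_module R M by fact
  have into: "?F f \<in> ?D" if "f \<in> ?H" for f
    using that
    by (auto simp: left_hom_def restrict_scalars_def regular_def Pi_def scalar_closed
        functional_closed functional_add functional_scalar M.smult_closed)
  have inj: "f = g" if f: "f \<in> ?H" and g: "g \<in> ?H" and eq: "?F f = ?F g" for f g
  proof (rule extensionalityI)
    show "f \<in> extensional (carrier M)" "g \<in> extensional (carrier M)" using f g by auto
    fix p assume p: "p \<in> carrier M"
    have "l (x \<otimes> f p) = l (x \<otimes> g p)" if x: "x \<in> carrier R" for x
    proof -
      have "l (f (x \<odot>\<^bsub>M\<^esub> p)) = l (g (x \<odot>\<^bsub>M\<^esub> p))"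
        using fun_cong[OF eq, of "x \<odot>\<^bsub>M\<^esub> p"] x p by (simp add: M.smult_closed)
      then show ?thesis using f g x p by (auto simp: left_hom_def regular_def)
    qed
    then show "f p = g p"
      using f g p by (intro nondegenerate) (auto simp: left_hom_def regular_def)
  qed
  have sur: "\<exists>f\<in>?H. ?F f = g" if g: "g \<in> ?D" for g
  proof -
    have g_add: "g (p \<oplus>\<^bsub>M\<^esub> q) = g p \<oplus>\<^bsub>K\<^esub> g q" if "p \<in> carrier M" "q \<in> carrier M" for p q
      using g that by (auto simp: left_hom_def restrict_scalars_def regular_def)
    have "(\<lambda>a. g (a \<odot>\<^bsub>M\<^esub> p)) \<in> left_hom K (restrict_scalars e (regular R)) (regular K)"
      if "p \<in> carrier M" for p
      using g that by (auto simp: left_hom_def restrict_scalars_def regular_def Pi_def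
          scalar_closed M.smult_closed M.smult_l_distr M.smult_assoc)
    from represents[OF this]
    have "\<exists>y\<in>carrier R. \<forall>x\<in>carrier R. g (x \<odot>\<^bsub>M\<^esub> p) = l (x \<otimes> y)" if "p \<in> carrier M" for p
      using that by blast
    then obtain f where f: "\<And>p. p \<in> carrier M \<Longrightarrow> f p \<in> carrier R"
      and fg: "\<And>p x. \<lbrakk>p \<in> carrier M; x \<in> carrier R\<rbrakk> \<Longrightarrow> l (x \<otimes> f p) = g (x \<odot>\<^bsub>M\<^esub> p)"
      by metis
    have add: "f (p \<oplus>\<^bsub>M\<^esub> q) = f p \<oplus> f q" if "p \<in> carrier M" "q \<in> carrier M" for p q
      by (rule nondegenerate)
        (use that in \<open>auto simp: f fg r_distr functional_add g_add M.smult_r_distr M.smult_closed\<close>)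
    have smult: "f (a \<odot>\<^bsub>M\<^esub> p) = a \<otimes> f p" if "a \<in> carrier R" "p \<in> carrier M" for a p
      by (rule nondegenerate)
        (use that in \<open>auto simp: f fg M.smult_closed M.smult_assoc m_assoc[symmetric]\<close>)
    have "restrict f (carrier M) \<in> ?H"
      using f add smult by (auto simp: left_hom_def regular_def M.smult_closed)
    moreover have "?F (restrict f (carrier M)) = g"
    proof (rule extensionalityI)
      show "g \<in> extensional (carrier M)" using g by auto
      fix p assume p: "p \<in> carrier M"
      show "?F (restrict f (carrier M)) p = g p"
        using fg[OF p one_closed] p by (simp add: f M.smult_one)
    qed auto
    ultimately show ?thesis by blast
  qed
  show ?thesis
  proof (rule bij_betw_imageI)
    show "inj_on ?F ?H" by (rule inj_onI, rule inj)
    show "?F ` ?H = ?D" using into sur by blast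
  qed
qed

end

section \<open>The Frobenius form\<close>

lemma ring_opposite:
  assumes "ring B" shows "ring (opposite B)"
proof -
  interpret ring B by fact
  show ?thesis
    by (rule ringI, rule abelian_groupI, goal_cases)
      (auto simp: opposite_def a_ac m_assoc l_distr r_distr intro: l_neg bexI[of _ "\<ominus>\<^bsub>B\<^esub> x" for x]
        intro!: monoidI)
qed

lemma (in fd_algebra) unit_scalar:
  assumes "c \<in> carrier K" "x \<in> carrier A"
  shows "(c \<odot>\<^bsub>A\<^esub> \<one>\<^bsub>A\<^esub>) \<otimes>\<^bsub>A\<^esub> x = c \<odot>\<^bsub>A\<^esub> x" "x \<otimes>\<^bsub>A\<^esub> (c \<odot>\<^bsub>A\<^esub> \<one>\<^bsub>A\<^esub>) = c \<odot>\<^bsub>A\<^esub> x"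
proof -
  interpret A: ring A by (rule ring)
  show "(c \<odot>\<^bsub>A\<^esub> \<one>\<^bsub>A\<^esub>) \<otimes>\<^bsub>A\<^esub> x = c \<odot>\<^bsub>A\<^esub> x" "x \<otimes>\<^bsub>A\<^esub> (c \<odot>\<^bsub>A\<^esub> \<one>\<^bsub>A\<^esub>) = c \<odot>\<^bsub>A\<^esub> x"
    using assms by (simp_all add: smult_mult_left smult_mult_right)
qed

text \<open>
  The form is the image of \<open>1\<close>. One-sided linearity of the isomorphism on each side yields that it
  generates the dual from the right and from the left; the second is recorded over the opposite ring.
\<close>

lemma frobenius_form:
  assumes "frobenius_algebra K A \<alpha>"
  obtains l where "generating_functional K A (\<lambda>c. c \<odot>\<^bsub>A\<^esub> \<one>\<^bsub>A\<^esub>) l"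
    and "generating_functional K (opposite A) (\<lambda>c. c \<odot>\<^bsub>A\<^esub> \<one>\<^bsub>A\<^esub>) l"
    and "\<And>a x. \<lbrakk>a \<in> carrier A; x \<in> carrier A\<rbrakk> \<Longrightarrow> l (a \<otimes>\<^bsub>A\<^esub> x) = l (x \<otimes>\<^bsub>A\<^esub> \<alpha> a)"
proof -
  interpret fd_algebra K A using assms by (simp add: frobenius_algebra_def)
  interpret A: ring A by (rule ring)
  interpret KA: module K A by (rule module)
  let ?e = "\<lambda>c. c \<odot>\<^bsub>A\<^esub> \<one>\<^bsub>A\<^esub>"
  let ?L = "left_hom K (restrict_scalars ?e (regular A)) (regular K)"
  let ?D = "carrier (k_dual K A (regular A))"
  have \<alpha>: "\<alpha> \<in> ring_iso A A"
    using assms by (simp add: frobenius_algebra_def algebra_automorphism_def)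
  then have \<alpha>_closed: "\<alpha> x \<in> carrier A" if "x \<in> carrier A" for x
    using that by (auto simp: ring_iso_def ring_hom_def)
  have \<alpha>_sur: "\<exists>y\<in>carrier A. x = \<alpha> y" if "x \<in> carrier A" for x
    using \<alpha> that by (auto simp: ring_iso_def bij_betw_def)
  obtain \<phi> where \<phi>: "\<phi> \<in> left_hom A (regular A) (left_twist \<alpha> (k_dual K A (regular A)))"
      "\<phi> \<in> right_hom A (regular A) (left_twist \<alpha> (k_dual K A (regular A)))"
    and bij: "bij_betw \<phi> (carrier A) ?D"
    using assms by (auto simp: frobenius_algebra_def bimodule_iso_def regular_def left_twist_def)
  have D: "h \<in> ?D \<longleftrightarrow> h \<in> ?L \<and> h \<in> extensional (carrier A)" for h
    by (simp add: k_dual_def left_hom_def k_space_def restrict_scalars_def regular_def)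
  define l where "l = \<phi> \<one>\<^bsub>A\<^esub>"
  have \<phi>D: "\<phi> a \<in> ?D" if "a \<in> carrier A" for a
    using bij_betwE[OF bij] that by blast
  have right: "\<phi> a x = l (a \<otimes>\<^bsub>A\<^esub> x)" if a: "a \<in> carrier A" and x: "x \<in> carrier A" for a x
  proof -
    have "\<forall>a\<in>carrier A. \<forall>b\<in>carrier A. \<phi> (b \<otimes>\<^bsub>A\<^esub> a) = (\<lambda>x\<in>carrier A. \<phi> b (a \<otimes>\<^bsub>A\<^esub> x))"
      using \<phi>(2) unfolding right_hom_def left_hom_def
      by (simp add: right_part_def opposite_def regular_def left_twist_def k_dual_def)
    then have "\<phi> (\<one>\<^bsub>A\<^esub> \<otimes>\<^bsub>A\<^esub> a) = (\<lambda>x\<in>carrier A. l (a \<otimes>\<^bsub>A\<^esub> x))"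
      using a A.one_closed unfolding l_def by blast
    then show ?thesis using a x by (simp add: l_def)
  qed
  have left: "\<phi> a x = l (x \<otimes>\<^bsub>A\<^esub> \<alpha> a)" if a: "a \<in> carrier A" and x: "x \<in> carrier A" for a x
  proof -
    have "\<forall>a\<in>carrier A. \<forall>b\<in>carrier A. \<phi> (a \<otimes>\<^bsub>A\<^esub> b) = (\<lambda>x\<in>carrier A. \<phi> b (x \<otimes>\<^bsub>A\<^esub> \<alpha> a))"
      using \<phi>(1) unfolding left_hom_def
      by (simp add: regular_def left_twist_def k_dual_def)
    then have "\<phi> (a \<otimes>\<^bsub>A\<^esub> \<one>\<^bsub>A\<^esub>) = (\<lambda>x\<in>carrier A. l (x \<otimes>\<^bsub>A\<^esub> \<alpha> a))"
      using a A.one_closed unfolding l_def by blast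
    then show ?thesis using a x by (simp add: l_def)
  qed
  have l: "l \<in> ?L" using \<phi>D[OF A.one_closed] by (simp add: D l_def)
  have rep: "\<exists>a\<in>carrier A. \<forall>x\<in>carrier A. h x = \<phi> a x" if h: "h \<in> ?L" for h
  proof -
    have "restrict h (carrier A) \<in> ?D"
      unfolding D using h
      by (auto simp: left_hom_def restrict_scalars_def regular_def KA.smult_closed)
    then obtain a where "a \<in> carrier A" "\<phi> a = restrict h (carrier A)"
      using bij unfolding bij_betw_def by (metis imageE)
    then show ?thesis by (metis restrict_apply')
  qed
  have eq: "a = b" if ab: "a \<in> carrier A" "b \<in> carrier A"
    and *: "\<And>x. x \<in> carrier A \<Longrightarrow> \<phi> a x = \<phi> b x" for a b
  proof -
    have "\<phi> a = \<phi> b" using \<phi>D[OF ab(1)] \<phi>D[OF ab(2)] *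
      by (intro extensionalityI[of _ "carrier A"]) (auto simp: D)
    then show ?thesis using bij ab by (auto simp: bij_betw_def inj_on_def)
  qed
  have gl: "generating_functional K A ?e l"
  proof (intro generating_functional.intro generating_functional_axioms.intro)
    show "\<exists>y\<in>carrier A. \<forall>x\<in>carrier A. h x = l (x \<otimes>\<^bsub>A\<^esub> y)" if "h \<in> ?L" for h
      using rep[OF that] left \<alpha>_closed by metis
    show "y = z" if "y \<in> carrier A" "z \<in> carrier A"
      "\<forall>x\<in>carrier A. l (x \<otimes>\<^bsub>A\<^esub> y) = l (x \<otimes>\<^bsub>A\<^esub> z)" for y z
      using \<alpha>_sur[OF that(1)] \<alpha>_sur[OF that(2)] that(3) eq left by metis
  qed (use l in \<open>auto intro: A.ring_axioms\<close>)
  \<comment> \<open>The scalars \<open>c\<cdot>1\<close> are central, so \<open>A\<close> and its opposite have the same functionals.\<close>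
  have op: "left_hom K (restrict_scalars ?e (regular (opposite A))) (regular K) = ?L"
    by (auto simp: left_hom_def restrict_scalars_def regular_def opposite_def unit_scalar)
  have gr: "generating_functional K (opposite A) ?e l"
  proof (intro generating_functional.intro generating_functional_axioms.intro, unfold op)
    show "\<exists>y\<in>carrier (opposite A). \<forall>x\<in>carrier (opposite A). h x = l (x \<otimes>\<^bsub>opposite A\<^esub> y)"
      if "h \<in> ?L" for h
      using rep[OF that] right by (auto simp: opposite_def)
    show "y = z" if "y \<in> carrier (opposite A)" "z \<in> carrier (opposite A)"
      "\<forall>x\<in>carrier (opposite A). l (x \<otimes>\<^bsub>opposite A\<^esub> y) = l (x \<otimes>\<^bsub>opposite A\<^esub> z)" for y z
      using that eq[of y z] right by (simp add: opposite_def)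
  qed (use l in \<open>auto simp: opposite_def intro: ring_opposite[OF ring, unfolded opposite_def]\<close>)
  show thesis using that[OF gl gr] left right by metis
qed

lemma left_twist_id: "left_twist (\<lambda>a. a) M = M"
  by (simp add: left_twist_def)

lemma symmetric_algebra_frobenius:
  assumes "symmetric_algebra K A"
  shows "frobenius_algebra K A (\<lambda>a. a)"
  using assms
  by (auto simp: symmetric_algebra_def frobenius_algebra_def left_twist_id
      algebra_automorphism_def ring_iso_def ring_hom_def bij_betw_def)

section \<open>The duals of a bimodule\<close>

text \<open>
  The isomorphism is \<open>G\<^sup>-\<^sup>1 \<circ> F\<close>. Closure of \<open>N\<close> under the operations makes \<open>G\<^sup>-\<^sup>1\<close> linear: the sum of
  two preimages is then the preimage of the sum, by injectivity of \<open>G\<close>.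
\<close>

lemma bimodule_iso_via:
  assumes F: "F \<in> left_hom A M Q \<inter> right_hom B M Q" "bij_betw F (carrier M) (carrier Q)"
    and G: "G \<in> left_hom A N Q \<inter> right_hom B N Q" "bij_betw G (carrier N) (carrier Q)"
    and add: "\<And>x y. \<lbrakk>x \<in> carrier N; y \<in> carrier N\<rbrakk> \<Longrightarrow> x \<oplus>\<^bsub>N\<^esub> y \<in> carrier N"
    and smult: "\<And>a x. \<lbrakk>a \<in> carrier A; x \<in> carrier N\<rbrakk> \<Longrightarrow> a \<odot>\<^bsub>N\<^esub> x \<in> carrier N"
    and ract: "\<And>b x. \<lbrakk>b \<in> carrier B; x \<in> carrier N\<rbrakk> \<Longrightarrow> x \<triangleleft>\<^bsub>N\<^esub> b \<in> carrier N"
  shows "bimodule_iso A B M N"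
proof -
  let ?G = "inv_into (carrier N) G"
  have G': "bij_betw ?G (carrier Q) (carrier N)" by (rule bij_betw_inv_into[OF G(2)])
  have bij: "bij_betw (\<lambda>x. ?G (F x)) (carrier M) (carrier N)"
    using bij_betw_trans[OF F(2) G'] by (simp add: comp_def)
  have closed: "F x \<in> carrier Q" "?G (F x) \<in> carrier N" "G (?G (F x)) = F x"
    if "x \<in> carrier M" for x
    using that bij_betwE[OF F(2)] bij_betwE[OF bij] bij_betw_inv_into_right[OF G(2)] by auto
  have eq: "?G z = y" if "y \<in> carrier N" "z = G y" for y z
    using that bij_betw_inv_into_left[OF G(2)] by simp
  have "(\<lambda>x. ?G (F x)) \<in> left_hom A M N \<inter> right_hom B M N"
    using F(1) G(1) closed add smult ract
    by (auto simp: left_hom_def right_hom_def right_part_def opposite_def intro!: eq)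
  then show ?thesis using bij unfolding bimodule_iso_def by blast
qed

lemma (in bimodule) left_dual_closed:
  assumes "f \<in> carrier (left_dual A M)"
  shows "g \<in> carrier (left_dual A M) \<Longrightarrow> f \<oplus>\<^bsub>left_dual A M\<^esub> g \<in> carrier (left_dual A M)"
    and "b \<in> carrier B \<Longrightarrow> b \<odot>\<^bsub>left_dual A M\<^esub> f \<in> carrier (left_dual A M)"
    and "a \<in> carrier A \<Longrightarrow> f \<triangleleft>\<^bsub>left_dual A M\<^esub> a \<in> carrier (left_dual A M)"
proof -
  note right_closed = right.smult_closed[unfolded right_part_def opposite_def, simplified]
  note right_distr = right.smult_r_distr[unfolded right_part_def opposite_def, simplified]
  note simps = left_dual_def left_hom_def regular_def Pi_def left.smult_closed
  show "g \<in> carrier (left_dual A M) \<Longrightarrow> f \<oplus>\<^bsub>left_dual A M\<^esub> g \<in> carrier (left_dual A M)"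
    using assms by (auto simp: simps left.R.a_ac left.R.r_distr)
  show "b \<in> carrier B \<Longrightarrow> b \<odot>\<^bsub>left_dual A M\<^esub> f \<in> carrier (left_dual A M)"
    using assms by (auto simp: simps right_closed right_distr assoc)
  show "a \<in> carrier A \<Longrightarrow> f \<triangleleft>\<^bsub>left_dual A M\<^esub> a \<in> carrier (left_dual A M)"
    using assms by (auto simp: simps left.R.l_distr left.R.m_assoc)
qed

theorem frobenius_algebras_dual_iso:
  assumes "bimodule K A B P" "frobenius_algebra K A \<alpha>" "frobenius_algebra K B \<beta>"
  shows "bimodule_iso B A (right_dual B P) (left_twist \<beta> (right_twist \<alpha> (left_dual A P)))"
proof -
  interpret bimodule K A B P by fact
  let ?eA = "\<lambda>c. c \<odot>\<^bsub>A\<^esub> \<one>\<^bsub>A\<^esub>" and ?eB = "\<lambda>c. c \<odot>\<^bsub>B\<^esub> \<one>\<^bsub>B\<^esub>"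
  obtain l where l: "generating_functional K A ?eA l"
    and l_swap: "\<And>a x. \<lbrakk>a \<in> carrier A; x \<in> carrier A\<rbrakk> \<Longrightarrow> l (a \<otimes>\<^bsub>A\<^esub> x) = l (x \<otimes>\<^bsub>A\<^esub> \<alpha> a)"
    by (rule frobenius_form[OF assms(2)]) (rule that)
  obtain m where m: "generating_functional K (opposite B) ?eB m"
    and m_swap: "\<And>b x. \<lbrakk>b \<in> carrier B; x \<in> carrier B\<rbrakk> \<Longrightarrow> m (b \<otimes>\<^bsub>B\<^esub> x) = m (x \<otimes>\<^bsub>B\<^esub> \<beta> b)"
    by (rule frobenius_form[OF assms(3)]) (rule that)
  interpret l: generating_functional K A ?eA l by (rule l)
  interpret m: generating_functional K "opposite B" ?eB m by (rule m)
  have \<alpha>_closed: "\<alpha> x \<in> carrier A" if "x \<in> carrier A" for x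
    using assms(2) that
    by (auto simp: frobenius_algebra_def algebra_automorphism_def ring_iso_def ring_hom_def)
  have \<beta>_closed: "\<beta> x \<in> carrier B" if "x \<in> carrier B" for x
    using assms(3) that
    by (auto simp: frobenius_algebra_def algebra_automorphism_def ring_iso_def ring_hom_def)
  note right_closed = right.smult_closed[unfolded right_part_def opposite_def, simplified]
  note m_add = m.functional_add[unfolded opposite_def, simplified]
  let ?N = "left_twist \<beta> (right_twist \<alpha> (left_dual A P))"
  let ?Q = "left_twist \<beta> (k_dual K A P)"
  let ?F = "\<lambda>f. \<lambda>x\<in>carrier P. m (f x)" and ?G = "\<lambda>f. \<lambda>x\<in>carrier P. l (f x)"
  have kA: "left_hom K (restrict_scalars ?eA P) (regular K) = left_hom K (k_space A P) (regular K)"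
    by (simp add: left_hom_def restrict_scalars_def k_space_def)
  \<comment> \<open>\<open>P\<close> has the same functionals as a left and as a right module because \<open>k\<close> acts centrally.\<close>
  have kB: "left_hom K (restrict_scalars ?eB (right_part P)) (regular K) =
      left_hom K (k_space A P) (regular K)"
    by (auto simp: left_hom_def restrict_scalars_def k_space_def right_part_def central)
  have regB: "left_hom (opposite B) (right_part P) (regular (opposite B)) = right_hom B P (regular B)"
    by (simp add: right_hom_def left_hom_def right_part_def regular_def opposite_def)
  have carrier_P: "carrier (right_part P) = carrier P" by (simp add: right_part_def)
  have bijG: "bij_betw ?G (carrier ?N) (carrier ?Q)"
    using l.bij_betw_functionals[OF left.left_module_axioms, unfolded kA]
    by (simp add: left_twist_def right_twist_def left_dual_def k_dual_def)
  have bijF: "bij_betw ?F (carrier (right_dual B P)) (carrier ?Q)"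
    using m.bij_betw_functionals[OF right.left_module_axioms, unfolded kB regB carrier_P]
    by (simp add: left_twist_def right_dual_def k_dual_def)
  have F: "?F \<in> left_hom B (right_dual B P) ?Q \<inter> right_hom A (right_dual B P) ?Q"
  proof -
    have closed: "f x \<in> carrier B" and ract: "b \<in> carrier B \<Longrightarrow> f (x \<triangleleft>\<^bsub>P\<^esub> b) = f x \<otimes>\<^bsub>B\<^esub> b"
      if "f \<in> carrier (right_dual B P)" "x \<in> carrier P" for f x b
      using that
      by (auto simp: right_dual_def right_hom_def left_hom_def right_part_def regular_def
          opposite_def)
    have "?F (f \<oplus>\<^bsub>right_dual B P\<^esub> g) = ?F f \<oplus>\<^bsub>?Q\<^esub> ?F g"
      if "f \<in> carrier (right_dual B P)" "g \<in> carrier (right_dual B P)" for f g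
      using closed that
      by (auto simp: right_dual_def left_twist_def k_dual_def m_add intro!: restrict_ext)
    moreover have "?F (b \<odot>\<^bsub>right_dual B P\<^esub> f) = b \<odot>\<^bsub>?Q\<^esub> ?F f"
      if f: "f \<in> carrier (right_dual B P)" and b: "b \<in> carrier B" for b f
    proof -
      have "m (b \<otimes>\<^bsub>B\<^esub> f x) = m (f (x \<triangleleft>\<^bsub>P\<^esub> \<beta> b))" if "x \<in> carrier P" for x
        using m_swap[OF b closed[OF f that]] ract[OF f that \<beta>_closed[OF b]] by simp
      then show ?thesis using \<beta>_closed[OF b]
        by (auto simp: right_dual_def left_twist_def k_dual_def right_closed intro!: restrict_ext)
    qed
    moreover have "?F (f \<triangleleft>\<^bsub>right_dual B P\<^esub> a) = ?F f \<triangleleft>\<^bsub>?Q\<^esub> a" if "a \<in> carrier A" for a f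
      using that
      by (auto simp: right_dual_def left_twist_def k_dual_def left.smult_closed
          intro!: restrict_ext)
    ultimately show ?thesis
      using bij_betwE[OF bijF] by (auto simp: left_hom_def right_hom_def right_part_def opposite_def)
  qed
  have G: "?G \<in> left_hom B ?N ?Q \<inter> right_hom A ?N ?Q"
  proof -
    have closed: "f x \<in> carrier A" and smult: "a \<in> carrier A \<Longrightarrow> f (a \<odot>\<^bsub>P\<^esub> x) = a \<otimes>\<^bsub>A\<^esub> f x"
      if "f \<in> carrier ?N" "x \<in> carrier P" for f x a
      using that
      by (auto simp: left_twist_def right_twist_def left_dual_def left_hom_def regular_def)
    have "?G (f \<oplus>\<^bsub>?N\<^esub> g) = ?G f \<oplus>\<^bsub>?Q\<^esub> ?G g"
      if "f \<in> carrier ?N" "g \<in> carrier ?N" for f g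
      using closed that
      by (auto simp: left_twist_def right_twist_def left_dual_def k_dual_def l.functional_add
          intro!: restrict_ext)
    moreover have "?G (b \<odot>\<^bsub>?N\<^esub> f) = b \<odot>\<^bsub>?Q\<^esub> ?G f" if "b \<in> carrier B" for b f
      using \<beta>_closed[OF that]
      by (auto simp: left_twist_def right_twist_def left_dual_def k_dual_def right_closed
          intro!: restrict_ext)
    moreover have "?G (f \<triangleleft>\<^bsub>?N\<^esub> a) = ?G f \<triangleleft>\<^bsub>?Q\<^esub> a"
      if f: "f \<in> carrier ?N" and a: "a \<in> carrier A" for a f
    proof -
      have "l (f x \<otimes>\<^bsub>A\<^esub> \<alpha> a) = l (f (a \<odot>\<^bsub>P\<^esub> x))" if "x \<in> carrier P" for x
        using l_swap[OF a closed[OF f that]] smult[OF f that a] by simp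
      then show ?thesis using a
        by (auto simp: left_twist_def right_twist_def left_dual_def k_dual_def left.smult_closed
            intro!: restrict_ext)
    qed
    ultimately show ?thesis
      using bij_betwE[OF bijG] by (auto simp: left_hom_def right_hom_def right_part_def opposite_def)
  qed
  show ?thesis
    by (rule bimodule_iso_via[OF F bijF G bijG])
      (auto simp: left_twist_def right_twist_def intro: left_dual_closed \<alpha>_closed \<beta>_closed)
qed

theorem lemma5p4:
  fixes K :: "('k, 'r) ring_scheme"
    and A :: "('k, 'a, 'x) module_scheme" and \<alpha> :: "'a \<Rightarrow> 'a"
    and B :: "('k, 'b, 'y) module_scheme" and \<beta> :: "'b \<Rightarrow> 'b"
    and P :: "('a, 'b, 'p, 'z) bimodule_scheme"
  assumes "bimodule K A B P"
    and "fin_gen_projective_left A P"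
    and "fin_gen_projective_right B P"
  shows "(frobenius_algebra K A \<alpha> \<and> frobenius_algebra K B \<beta> \<longrightarrow>
           twisted_frobenius_bimodule K A \<alpha> B \<beta> P) \<and>
         (symmetric_algebra K A \<and> symmetric_algebra K B \<longrightarrow> frobenius_bimodule K A B P)"
proof -
  have "twisted_frobenius_bimodule K A \<gamma> B \<delta> P"
    if "frobenius_algebra K A \<gamma>" "frobenius_algebra K B \<delta>" for \<gamma> \<delta>
    using assms that frobenius_algebras_dual_iso[OF assms(1) that]
    by (simp add: twisted_frobenius_bimodule_def frobenius_algebra_def)
  then show ?thesis
    by (auto simp: frobenius_bimodule_def intro: symmetric_algebra_frobenius)
qed

end
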